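(* For every integer $j \geq 1$ the following hold: (I) $\delta_{BM}(P_4, P_{8j}) = \sqrt 2$, (II) $\delta_{BM}(P_4, P_{8j+2}) \leq \frac{1}{2}\sec\frac{2j}{8j+2}\pi + \cos\frac{2j}{8j+2}\pi$, (III) $\delta_{BM}(P_4, P_{8j+4}) = \sqrt 2\,\cos\frac{1}{8j+4}\pi$, (IV) $\delta_{BM}(P_4, P_{8j+6}) \leq \sin\frac{2j+2}{8j+6}\pi \cdot \csc\frac{4j+2}{8j+6}\pi + \cos\frac{2j+2}{8j+6}\pi$.
   Context: $\mathcal{M}^2$ denotes the family of all centrally symmetric convex bodies (compact convex sets with non-empty interior) of the Euclidean plane $E^2$ centered at the origin $o$. For $K \in \mathcal{M}^2$ and $\lambda > 0$, $\lambda K$ is the image of $K$ under the homothety with center $o$ and ratio $\lambda$. The Banach-Mazur distance of $C, D \in \mathcal{M}^2$ is $\delta_{BM}(C,D) = \inf_{a,\lambda}\{\lambda : a(C) \subset D \subset \lambda a(C)\}$, where $a$ ranges over affine transformations of $E^2$ and $\lambda$ over positive reals. $P_n$ denotes the regular $n$-gon with vertices $(\cos\frac{2i}{n}\pi, \sin\frac{2i}{n}\pi)$ for $i = 0, \dots, n-1$. *)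

theory Defs
  imports "HOL-Analysis.Analysis"
begin

definition affine_transformation :: "('a::real_vector \<Rightarrow> 'a) \<Rightarrow> bool" where
  "affine_transformation a \<longleftrightarrow> (\<exists>L v. linear L \<and> bij L \<and> a = (\<lambda>x. L x + v))"

text \<open>
  Intended for centrally symmetric convex bodies centered at the origin. The homothety of ratio
  \<open>r\<close> has center the origin, and \<open>a\<close> ranges over all invertible affine maps, not only the
  linear ones. For such bodies the set is non-empty and bounded below by \<open>0\<close>, so the infimum of
  reals is meaningful.
\<close>

definition banach_mazur_dist :: "(real^2) set \<Rightarrow> (real^2) set \<Rightarrow> real" where
  "banach_mazur_dist C D =
     Inf {r. r > 0 \<and> (\<exists>a. affine_transformation a \<and>
                a ` C \<subseteq> D \<and> D \<subseteq> (\<lambda>x. r *\<^sub>R x) ` (a ` C))}"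

definition regular_polygon :: "nat \<Rightarrow> (real^2) set" where
  "regular_polygon n =
     convex hull ((\<lambda>i. vector [cos (2 * real i / real n * pi), sin (2 * real i / real n * pi)])
       ` {0..<n})"

end

theory Submission
  imports Defs
begin

text \<open>
  Let \<open>a(P\<^sub>4) \<subseteq> P\<^sub>n \<subseteq> r a(P\<^sub>4)\<close>. By symmetry \<open>a\<close> may be taken linear, so \<open>a(P\<^sub>4)\<close> has half-diagonals
  \<open>u, w \<in> P\<^sub>n\<close>; its two pairs of sides are given by functionals \<open>p, q\<close> with
  \<open>p \<bullet> u = p \<bullet> w = q \<bullet> u = 1\<close> and \<open>q \<bullet> w = -1\<close>. For the support function \<open>h\<close> of \<open>P\<^sub>n\<close> this means
  \<open>h(p), h(q) \<le> r\<close> whereas \<open>h(p + q), h(p - q) \<ge> 2\<close>. If \<open>8\<close> divides \<open>n\<close>, then \<open>h\<close> is invariant under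
  rotation by \<open>\<pi>/4\<close>, and the James constant of such a norm is \<open>\<surd>2\<close>, that is
  \<open>min (h(p + q)) (h(p - q)) \<le> \<surd>2 max (h(p)) (h(q))\<close>; hence \<open>r \<ge> \<surd>2\<close>. In general
  \<open>cos (\<pi>/n) |z| \<le> h(z) \<le> |z|\<close>, and the parallelogram law yields \<open>r \<ge> \<surd>2 cos (\<pi>/n)\<close>.
  The upper bounds come from the rhombi with half-diagonals \<open>(1, 0)\<close> and \<open>(0, c)\<close>, where \<open>c = 1\<close> if
  \<open>4\<close> divides \<open>n\<close>, and \<open>c = cos (\<pi>/n)\<close> if \<open>(0, c)\<close> is the midpoint of an edge.
\<close>

section \<open>Directions and polar form in the plane\<close>

definition dir :: "real \<Rightarrow> real^2" where
  "dir t = vector [cos t, sin t]"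

lemma dir_nth [simp]: "dir t $ 1 = cos t" "dir t $ 2 = sin t"
  by (simp_all add: dir_def)

lemma inner_real2: "(x::real^2) \<bullet> y = x $ 1 * y $ 1 + x $ 2 * y $ 2"
  by (simp add: inner_vec_def sum_2)

lemma norm_dir [simp]: "norm (dir t) = 1"
  by (simp add: norm_eq_sqrt_inner inner_real2 flip: power2_eq_square)

lemma real2_polar: "\<exists>t. (z::real^2) = norm z *\<^sub>R dir t"
proof (cases "z = 0")
  case False
  have "(z $ 1 / norm z)\<^sup>2 + (z $ 2 / norm z)\<^sup>2 = (z \<bullet> z) / (norm z)\<^sup>2"
    by (simp add: inner_real2 power_divide add_divide_distrib power2_eq_square)
  also have "\<dots> = 1"
    using False by (simp add: power2_norm_eq_inner)
  finally obtain t where "z $ 1 / norm z = cos t" "z $ 2 / norm z = sin t"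
    using sincos_total_2pi by metis
  then have "z $ 1 = norm z * cos t" "z $ 2 = norm z * sin t"
    using False by (simp_all add: field_simps)
  then have "z = norm z *\<^sub>R dir t"
    by (simp add: vec_eq_iff forall_2)
  then show ?thesis ..
qed simp


subsection \<open>Regular polygons\<close>

text \<open>The index is an integer, read cyclically, so that reflection, negation and rotation of
  the polygon become \<open>- i\<close>, \<open>i + n div 2\<close> and a shift of \<open>i\<close>,
  with no case distinction at the ends of the range.\<close>

definition vertex :: "nat \<Rightarrow> int \<Rightarrow> real^2" where
  "vertex n i = dir (2 * of_int i * pi / real n)"

lemma vertex_mod: "n > 0 \<Longrightarrow> vertex n (i mod int n) = vertex n i"
proof -
  assume "n > 0"
  define k where "k = i div int n"
  have "i = int n * k + i mod int n"
    by (simp add: k_def)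
  then have "real_of_int i = real n * of_int k + of_int (i mod int n)"
    by (metis of_int_add of_int_mult of_int_of_nat_eq)
  then have "2 * of_int i * pi / real n
      = 2 * of_int (i mod int n) * pi / real n + 2 * pi * of_int k"
    using \<open>n > 0\<close> by (simp add: field_simps)
  then show ?thesis
    by (simp only: vertex_def dir_def sin_cos_eq_iff[THEN iffD2]
        sin_add cos_add sin_int_2pin cos_int_2pin) simp
qed

lemma regular_polygon_eq_hull_vertex:
  assumes "n > 0"
  shows "regular_polygon n = convex hull (range (vertex n))"
proof -
  have *: "vector [cos (2 * real i / real n * pi), sin (2 * real i / real n * pi)] = vertex n (int i)"
    for i
    by (simp add: vertex_def dir_def mult_ac)
  have "range (vertex n) = vertex n ` int ` {0..<n}"
  proof (intro equalityI subsetI)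
    fix x assume "x \<in> range (vertex n)"
    then obtain i where "x = vertex n i" by blast
    then have "x = vertex n (int (nat (i mod int n)))"
      using assms vertex_mod by simp
    moreover have "nat (i mod int n) \<in> {0..<n}"
      using assms by (simp add: nat_less_iff)
    ultimately show "x \<in> vertex n ` int ` {0..<n}" by blast
  qed blast
  then show ?thesis
    unfolding regular_polygon_def * by (simp add: image_image)
qed

lemma pi_divide_nat:
  assumes "n \<ge> 3"
  shows "0 < pi / real n" "pi / real n < pi / 2"
  using assms by (simp, intro divide_strict_left_mono) auto

lemma convex_regular_polygon: "convex (regular_polygon n)"
  by (simp add: regular_polygon_def)

lemma vertex_in_regular_polygon: "n > 0 \<Longrightarrow> vertex n i \<in> regular_polygon n"
  by (simp add: regular_polygon_eq_hull_vertex hull_inc)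

lemma regular_polygon_minimal:
  assumes "n > 0" "convex S" "\<And>i. vertex n i \<in> S"
  shows "regular_polygon n \<subseteq> S"
  unfolding regular_polygon_eq_hull_vertex[OF assms(1)]
  by (rule hull_minimal) (use assms in auto)

lemma uminus_vertex:
  assumes "n > 0" "even n"
  shows "- vertex n i = vertex n (i + int (n div 2))"
proof -
  have "2 * real_of_int (i + int (n div 2)) * pi / real n = 2 * of_int i * pi / real n + pi"
    using assms by (auto elim!: evenE simp: field_simps)
  then show ?thesis
    by (simp add: vertex_def vec_eq_iff forall_2 del: of_int_add)
qed

lemma uminus_regular_polygon:
  assumes "n > 0" "even n" "x \<in> regular_polygon n"
  shows "- x \<in> regular_polygon n"
proof -
  have "regular_polygon n \<subseteq> uminus ` regular_polygon n"
  proof (rule regular_polygon_minimal)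
    show "convex (uminus ` regular_polygon n)"
      by (simp add: convex_negations convex_regular_polygon)
    show "vertex n i \<in> uminus ` regular_polygon n" for i
      using vertex_in_regular_polygon[of n "i + int (n div 2)"] uminus_vertex[of n i] assms
      by (metis imageI minus_minus)
  qed (use assms in simp)
  then show ?thesis using assms by force
qed

lemma norm_regular_polygon_le:
  assumes "n > 0" "x \<in> regular_polygon n"
  shows "norm x \<le> 1"
proof -
  have "regular_polygon n \<subseteq> cball 0 1"
    using assms(1) by (intro regular_polygon_minimal) (auto simp: vertex_def)
  then show ?thesis using assms by auto
qed

text \<open>This places a whole rhombus inside a symmetric convex set once its half-diagonals
  \<open>u\<close> and \<open>w\<close> lie there. Signs are absorbed into \<open>u\<close> and
  \<open>w\<close>, and the missing weight is put on the origin.\<close>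

lemma combination_in_convex_symmetric:
  fixes S :: "'a::real_vector set"
  assumes "convex S" "\<And>x. x \<in> S \<Longrightarrow> - x \<in> S" "u \<in> S" "w \<in> S" "\<bar>s\<bar> + \<bar>t\<bar> \<le> 1"
  shows "s *\<^sub>R u + t *\<^sub>R w \<in> S"
proof -
  define u' w' where "u' = (if s \<ge> 0 then u else - u)" and "w' = (if t \<ge> 0 then w else - w)"
  have "u' \<in> S" "w' \<in> S"
    using assms by (auto simp: u'_def w'_def)
  moreover have "0 \<in> S"
    using convexD[OF assms(1,3) assms(2)[OF assms(3)], of "1/2" "1/2"] by simp
  ultimately have "\<bar>s\<bar> *\<^sub>R u' + \<bar>t\<bar> *\<^sub>R w' + (1 - \<bar>s\<bar> - \<bar>t\<bar>) *\<^sub>R 0 \<in> S"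
    using assms(1,5) unfolding convex_alt
    using convex_sum[of "{0,1,2::nat}" S "\<lambda>i. if i = 0 then \<bar>s\<bar> else if i = 1 then \<bar>t\<bar> else 1 - \<bar>s\<bar> - \<bar>t\<bar>"
        "\<lambda>i. if i = 0 then u' else if i = 1 then w' else 0"] assms(1)
    by (auto simp: add_ac)
  then show ?thesis
    by (auto simp: u'_def w'_def split: if_splits)
qed

text \<open>As the unit ball of the sum norm, the square admits a membership test by coordinates.
  Both the rhombi of the upper bounds and the side normals of the lower bounds rely on it.\<close>

lemma regular_polygon_4: "regular_polygon 4 = {x. \<bar>x $ 1\<bar> + \<bar>x $ 2\<bar> \<le> 1}"
proof (intro equalityI subsetI)
  have "convex {x::real^2. \<bar>x $ 1\<bar> + \<bar>x $ 2\<bar> \<le> 1}"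
  proof (rule convexI, simp)
    fix x y :: "real^2" and s t :: real
    assume *: "\<bar>x $ 1\<bar> + \<bar>x $ 2\<bar> \<le> 1" "\<bar>y $ 1\<bar> + \<bar>y $ 2\<bar> \<le> 1" "0 \<le> s" "0 \<le> t" "s + t = 1"
    have "\<bar>s * x $ k + t * y $ k\<bar> \<le> s * \<bar>x $ k\<bar> + t * \<bar>y $ k\<bar>" for k
      using * abs_triangle_ineq[of "s * x $ k" "t * y $ k"] by (simp add: abs_mult)
    from this[of 1] this[of 2]
    have "\<bar>s * x $ 1 + t * y $ 1\<bar> + \<bar>s * x $ 2 + t * y $ 2\<bar>
        \<le> s * (\<bar>x $ 1\<bar> + \<bar>x $ 2\<bar>) + t * (\<bar>y $ 1\<bar> + \<bar>y $ 2\<bar>)"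
      by (simp add: algebra_simps)
    also have "\<dots> \<le> 1"
      using * by (intro convex_bound_le) auto
    finally show "\<bar>s * x $ 1 + t * y $ 1\<bar> + \<bar>s * x $ 2 + t * y $ 2\<bar> \<le> 1" .
  qed
  then have "regular_polygon 4 \<subseteq> {x. \<bar>x $ 1\<bar> + \<bar>x $ 2\<bar> \<le> 1}"
    unfolding regular_polygon_def
  proof (rule hull_minimal[rotated], clarify)
    fix i :: nat
    assume "i \<in> {0..<4}"
    then have "i \<in> {0, 1, 2, 3}" by auto
    then show "\<bar>(vector [cos (2 * real i / real 4 * pi), sin (2 * real i / real 4 * pi)] :: real^2) $ 1\<bar>
        + \<bar>(vector [cos (2 * real i / real 4 * pi), sin (2 * real i / real 4 * pi)] :: real^2) $ 2\<bar> \<le> 1"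
      using cos_3over2_pi sin_3over2_pi by auto
  qed
  then show "x \<in> {x. \<bar>x $ 1\<bar> + \<bar>x $ 2\<bar> \<le> 1}" if "x \<in> regular_polygon 4" for x
    using that by blast
  show "x \<in> regular_polygon 4" if "x \<in> {x. \<bar>x $ 1\<bar> + \<bar>x $ 2\<bar> \<le> 1}" for x
  proof -
    have "x = (x $ 1) *\<^sub>R vertex 4 0 + (x $ 2) *\<^sub>R vertex 4 1"
      by (simp add: vertex_def vec_eq_iff forall_2)
    then show ?thesis
      using combination_in_convex_symmetric[of "regular_polygon 4" "vertex 4 0" "vertex 4 1" "x $ 1" "x $ 2"]
        that convex_regular_polygon uminus_regular_polygon[of 4] vertex_in_regular_polygon[of 4]
      by simp
  qed
qed


subsection \<open>Upper bounds\<close>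

lemma banach_mazur_dist_le:
  assumes "r > 0" "affine_transformation a" "a ` C \<subseteq> D" "D \<subseteq> (\<lambda>x. r *\<^sub>R x) ` (a ` C)"
  shows "banach_mazur_dist C D \<le> r"
  unfolding banach_mazur_dist_def
  using assms by (intro cInf_lower bdd_belowI[of _ 0]) (auto intro: less_imp_le)

text \<open>The map is diagonal with entries 1 and \<open>c\<close>, so the image of the square is
  the rhombus with half-diagonals (1, 0) and (0, \<open>c\<close>). The bound \<open>le\<close>
  concerns one side of the rhombus only; the reflection \<open>i\<close> to \<open>- i\<close> and
  the half turn \<open>i\<close> to \<open>i + n div 2\<close> carry it to the other three.\<close>

lemma rhombus_sandwich:
  assumes "n > 0" "even n" "c > 0" "r > 0"
    and w: "vector [0, c] \<in> regular_polygon n"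
    and le: "\<And>i. cos (2 * of_int i * pi / real n) + sin (2 * of_int i * pi / real n) / c \<le> r"
  shows "\<exists>a. affine_transformation a \<and> a ` regular_polygon 4 \<subseteq> regular_polygon n \<and>
    regular_polygon n \<subseteq> (\<lambda>x. r *\<^sub>R x) ` (a ` regular_polygon 4)"
proof -
  define L where "L = (\<lambda>x::real^2. vector [x $ 1, c * x $ 2] :: real^2)"
  have lin: "linear L"
    by (rule linearI) (simp_all add: L_def vec_eq_iff forall_2 algebra_simps)
  have L_inv: "L (vector [x $ 1, x $ 2 / c]) = x" for x
    using \<open>c > 0\<close> by (simp add: L_def vec_eq_iff forall_2)
  have "bij L"
  proof (rule bijI)
    show "inj L"
      using \<open>c > 0\<close> by (auto simp: inj_def L_def vec_eq_iff forall_2)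
    show "surj L"
      using L_inv by (metis surj_def)
  qed
  then have aff: "affine_transformation L"
    unfolding affine_transformation_def using lin by (intro exI[of _ L] exI[of _ 0]) simp
  have "L x \<in> regular_polygon n" if "\<bar>x $ 1\<bar> + \<bar>x $ 2\<bar> \<le> 1" for x
  proof -
    have "L x = (x $ 1) *\<^sub>R vertex n 0 + (x $ 2) *\<^sub>R vector [0, c]"
      by (simp add: L_def vertex_def vec_eq_iff forall_2)
    then show ?thesis
      using combination_in_convex_symmetric[of "regular_polygon n" "vertex n 0" "vector [0, c]" "x $ 1" "x $ 2"]
        that convex_regular_polygon uminus_regular_polygon[of n] vertex_in_regular_polygon[of n]
        w assms by simp
  qed
  then have 1: "L ` regular_polygon 4 \<subseteq> regular_polygon n"
    by (auto simp: regular_polygon_4)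
  have 2: "regular_polygon n \<subseteq> (\<lambda>x. r *\<^sub>R x) ` (L ` regular_polygon 4)"
  proof (rule regular_polygon_minimal)
    show "convex ((\<lambda>x. r *\<^sub>R x) ` (L ` regular_polygon 4))"
      by (intro convex_scaling convex_linear_image lin convex_regular_polygon)
    fix i
    define t where "t = 2 * of_int i * pi / real n"
    have up: "cos t + sin t / c \<le> r"
      using le[of i] by (simp add: t_def)
    have down: "cos t - sin t / c \<le> r"
      using le[of "- i"] by (simp add: t_def)
    have "vertex n i = dir t" by (simp add: vertex_def t_def)
    \<comment> \<open>The half turn changes both signs; combined with the reflection it changes the
      sign of the cosine alone.\<close>
    have "- dir t = vertex n (i + int (n div 2))"
      using uminus_vertex[of n i] assms by (simp add: vertex_def t_def)
    then have m: "- cos t = cos (2 * of_int (i + int (n div 2)) * pi / real n)"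
        "- sin t = sin (2 * of_int (i + int (n div 2)) * pi / real n)"
      unfolding vertex_def by (metis dir_nth vector_uminus_component)+
    have up': "- cos t - sin t / c \<le> r"
      using le[of "i + int (n div 2)"] unfolding m[symmetric] by simp
    have down': "- cos t + sin t / c \<le> r"
      using le[of "- (i + int (n div 2))"]
      unfolding of_int_minus mult_minus_right mult_minus_left minus_divide_left[symmetric]
        cos_minus sin_minus m[symmetric] by simp
    have "\<bar>cos t\<bar> + \<bar>sin t / c\<bar> \<le> r"
      using up down up' down' by linarith
    then have "(\<bar>cos t\<bar> + \<bar>sin t / c\<bar>) / r \<le> 1"
      using \<open>r > 0\<close> by simp
    then have "\<bar>cos t / r\<bar> + \<bar>sin t / c / r\<bar> \<le> 1"
      using \<open>r > 0\<close> by (simp add: add_divide_distrib abs_mult)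
    then have "vector [cos t / r, sin t / c / r] \<in> regular_polygon 4"
      by (simp add: regular_polygon_4)
    moreover have "vertex n i = r *\<^sub>R L (vector [cos t / r, sin t / c / r])"
      using \<open>r > 0\<close> \<open>c > 0\<close> \<open>vertex n i = dir t\<close> by (simp add: L_def vec_eq_iff forall_2)
    ultimately show "vertex n i \<in> (\<lambda>x. r *\<^sub>R x) ` (L ` regular_polygon 4)"
      by blast
  qed (use assms in simp)
  show ?thesis
    using aff 1 2 by blast
qed

text \<open>Among the nonzero residues modulo \<open>N\<close>, those nearest to 0 give the largest
  cosine. After reduction, a residue beyond \<open>N / 2\<close> is reflected to
  \<open>N - m\<close>, so that the angle lies where cosine decreases.\<close>

lemma cos_nonzero_multiple_le:
  fixes k :: int and N :: nat
  assumes "N > 0" "\<not> int N dvd k"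
  shows "cos (2 * of_int k * pi / real N) \<le> cos (2 * pi / real N)"
proof -
  define m where "m = k mod int N"
  have m: "1 \<le> m" "m \<le> int N - 1"
    using assms by (auto simp: m_def dvd_eq_mod_eq_0) (smt (verit) pos_mod_bound pos_mod_sign of_nat_0_less_iff)+
  have "cos (2 * of_int k * pi / real N) = cos (2 * of_int m * pi / real N)"
    using vertex_mod[OF \<open>N > 0\<close>, of k] unfolding vertex_def m_def by (metis dir_nth(1))
  also have "\<dots> \<le> cos (2 * pi / real N)"
  proof (cases "2 * m \<le> int N")
    case True
    then have "2 * real_of_int m \<le> real N"
      by linarith
    with m show ?thesis
      by (intro cos_monotone_0_pi_le) (simp_all add: field_simps)
  next
    case False
    then have "2 * real_of_int m \<ge> real N" "real_of_int m \<le> real N - 1"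
      using m by linarith+
    then have "cos (2 * (real N - of_int m) * pi / real N) \<le> cos (2 * pi / real N)"
      using \<open>N > 0\<close> mult_left_mono[of "1 + real_of_int m" "real N" pi]
      by (intro cos_monotone_0_pi_le) (simp_all add: field_simps)
    moreover have "2 * (real N - of_int m) * pi / real N = 2 * pi - 2 * of_int m * pi / real N"
      using \<open>N > 0\<close> by (simp add: field_simps)
    ultimately show ?thesis by simp
  qed
  finally show ?thesis .
qed

text \<open>
  The last hypothesis says that the functional \<open>(A, B)\<close> is at vertex \<open>i\<^sub>0\<close> at least as large as at the
  two neighbouring vertices, whose angles are \<open>a \<plusminus> 2 d\<close>.
\<close>

lemma vertex_local_max:
  fixes n :: nat and i\<^sub>0 i :: int
  defines "d \<equiv> pi / real n" and "a \<equiv> 2 * of_int i\<^sub>0 * pi / real n"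
  assumes n: "n \<ge> 3"
    and T: "\<bar>B * cos a - A * sin a\<bar> * cos d \<le> (A * cos a + B * sin a) * sin d"
  shows "A * cos (2 * of_int i * pi / real n) + B * sin (2 * of_int i * pi / real n)
    \<le> A * cos a + B * sin a"
proof -
  define k where "k = i - i\<^sub>0"
  define y where "y = of_int k * d"
  define M where "M = A * cos a + B * sin a"
  define T' where "T' = B * cos a - A * sin a"
  have "sin d > 0"
    using pi_divide_nat[OF n] unfolding d_def by (intro sin_gt_zero) linarith+
  have "cos d \<ge> 0"
    using pi_divide_nat[OF n] unfolding d_def by (intro cos_ge_zero) linarith+
  have theta: "2 * of_int i * pi / real n = a + 2 * y"
    using n by (simp add: a_def y_def k_def d_def field_simps)
  \<comment> \<open>Here \<open>y\<close> is half the angle from vertex \<open>i\<^sub>0\<close> to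
    vertex \<open>i\<close>, \<open>M\<close> is the value of the functional at
    \<open>i\<^sub>0\<close> and \<open>T'\<close> its tangential component there. It remains to see
    that the subtracted term is nonnegative.\<close>
  have eq: "A * cos (a + 2 * y) + B * sin (a + 2 * y) = M - 2 * sin y * (sin y * M - cos y * T')"
    unfolding cos_add sin_add cos_double_sin sin_double M_def T'_def by (simp add: algebra_simps power2_eq_square)
  have "sin y * (cos y * T') \<le> sin y * (sin y * M)"
  proof (cases "int n dvd k")
    case True
    then obtain l where "k = int n * l" by blast
    then have "y = of_int l * pi"
      using n by (simp add: y_def d_def)
    then have "sin y = 0" using sin_zero_iff_int2 by blast
    then show ?thesis by simp
  next
    case False
    \<comment> \<open>For a vertex other than \<open>i\<^sub>0\<close>, \<open>y\<close> is at least
      as far from the multiples of \<open>pi\<close> as \<open>d\<close>. So the sine grows and the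
      cosine shrinks in absolute value, and the hypothesis at \<open>d\<close> passes to
      \<open>y\<close>.\<close>
    have "cos (2 * y) \<le> cos (2 * d)"
      using cos_nonzero_multiple_le[of n k] n False by (simp add: y_def d_def mult_ac)
    then have "(sin d)\<^sup>2 \<le> (sin y)\<^sup>2" and "(cos y)\<^sup>2 \<le> (cos d)\<^sup>2"
      using cos_double_sin[of y] cos_double_sin[of d] cos_double_cos[of y] cos_double_cos[of d]
      by linarith+
    then have s: "sin d \<le> \<bar>sin y\<bar>" and c: "\<bar>cos y\<bar> \<le> cos d"
      using \<open>sin d > 0\<close> \<open>cos d \<ge> 0\<close> abs_le_square_iff[of "sin d" "sin y"]
        abs_le_square_iff[of "cos y" "cos d"] by simp_all
    have "M \<ge> 0"
    proof -
      have "0 \<le> \<bar>T'\<bar> * cos d"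
        using \<open>cos d \<ge> 0\<close> by simp
      also have "\<dots> \<le> M * sin d"
        using T by (simp add: M_def T'_def)
      finally show ?thesis
        using \<open>sin d > 0\<close> by (simp add: zero_le_mult_iff)
    qed
    have "\<bar>cos y\<bar> * \<bar>T'\<bar> \<le> cos d * \<bar>T'\<bar>"
      using c by (intro mult_right_mono) auto
    also have "\<dots> \<le> sin d * M"
      using T by (simp add: M_def T'_def mult.commute)
    also have "\<dots> \<le> \<bar>sin y\<bar> * M"
      using s \<open>M \<ge> 0\<close> by (rule mult_right_mono)
    finally have "\<bar>sin y\<bar> * (\<bar>cos y\<bar> * \<bar>T'\<bar>) \<le> \<bar>sin y\<bar> * (\<bar>sin y\<bar> * M)"
      by (intro mult_left_mono) auto
    moreover have "sin y * (cos y * T') \<le> \<bar>sin y\<bar> * (\<bar>cos y\<bar> * \<bar>T'\<bar>)"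
      by (metis abs_ge_self abs_mult)
    moreover have "\<bar>sin y\<bar> * (\<bar>sin y\<bar> * M) = sin y * (sin y * M)"
      by (metis abs_mult_self mult.assoc)
    ultimately show ?thesis by linarith
  qed
  then show ?thesis
    unfolding theta eq M_def[symmetric] by (simp add: algebra_simps)
qed

text \<open>The conditions on \<open>a\<close> amount to \<open>2 * a\<close> being
  \<open>pi / 2 - d\<close> or \<open>pi / 2 + d\<close>: vertex \<open>i\<^sub>0\<close> is a
  vertex nearest to the diagonal direction, from either side. The bound is the value at this vertex
  of the functional (1, \<open>1 / cos d\<close>) that defines a side of the rhombus with
  half-diagonals (1, 0) and (0, \<open>cos d\<close>).\<close>

lemma banach_mazur_dist_rhombus_le:
  fixes n :: nat and i\<^sub>0 :: int
  defines "d \<equiv> pi / real n" and "a \<equiv> 2 * of_int i\<^sub>0 * pi / real n"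
  assumes n: "n \<ge> 3" "even n" "odd (n div 2)"
    and a: "0 < a" "a < pi / 2" "sin (2 * a) = cos d" "\<bar>cos (2 * a)\<bar> = sin d"
  shows "banach_mazur_dist (regular_polygon 4) (regular_polygon n) \<le> cos a + sin a / cos d"
proof -
  have pos: "sin a > 0" "cos a > 0"
    using a by (auto intro: sin_gt_zero cos_gt_zero)
  have cd: "cos d = 2 * sin a * cos a"
    using a(3) by (simp add: sin_double)
  then have "cos d > 0"
    using pos by simp
  have w: "vector [0, cos d] \<in> regular_polygon n"
  proof -
    obtain m where m: "n div 2 = 2 * m + 1"
      using n(3) by (auto elim: oddE)
    then have nm: "real n = 4 * real m + 2"
      using n(2) by (auto elim!: evenE)
    \<comment> \<open>Since \<open>n = 4 * m + 2\<close>, the direction \<open>pi / 2\<close> falls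
      midway between the vertices \<open>m\<close> and \<open>m + 1\<close>, and their midpoint is
      (0, \<open>cos d\<close>).\<close>
    have e: "2 * real_of_int (int m) * pi / real n = pi / 2 - d"
      "2 * real_of_int (int m + 1) * pi / real n = pi / 2 + d"
      by (simp_all add: d_def nm field_simps)
    have "(1/2) *\<^sub>R vertex n (int m) + (1/2) *\<^sub>R vertex n (int m + 1) \<in> regular_polygon n"
      using n by (intro convexD convex_regular_polygon vertex_in_regular_polygon) auto
    also have "(1/2) *\<^sub>R vertex n (int m) + (1/2) *\<^sub>R vertex n (int m + 1) = vector [0, cos d]"
      unfolding vertex_def e by (simp add: vec_eq_iff forall_2 cos_add sin_add cos_diff sin_diff)
    finally show ?thesis .
  qed
  have T: "\<bar>1 / cos d * cos a - 1 * sin a\<bar> * cos d \<le> (1 * cos a + 1 / cos d * sin a) * sin d"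
  proof -
    \<comment> \<open>Substituting \<open>cos d = 2 * sin a * cos a\<close> reduces the left side of
      \<open>T\<close> to \<open>sin d * cos a\<close>, which is already the first summand on the
      right.\<close>
    have "1 / cos d * cos a - 1 * sin a = cos (2 * a) / (2 * sin a)"
      unfolding cd cos_double_sin using pos by (simp add: field_simps power2_eq_square)
    then have "\<bar>1 / cos d * cos a - 1 * sin a\<bar> * cos d = sin d * cos a"
      using pos by (simp add: abs_divide a(4) cd)
    also have "\<dots> \<le> (1 * cos a + 1 / cos d * sin a) * sin d"
      using pos \<open>cos d > 0\<close> a(4) by (simp add: algebra_simps flip: a(4))
    finally show ?thesis .
  qed
  have "\<exists>b. affine_transformation b \<and> b ` regular_polygon 4 \<subseteq> regular_polygon n \<and>
    regular_polygon n \<subseteq> (\<lambda>x. (cos a + sin a / cos d) *\<^sub>R x) ` (b ` regular_polygon 4)"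
  proof (rule rhombus_sandwich[OF _ n(2) \<open>cos d > 0\<close> _ w])
    show "cos a + sin a / cos d > 0"
      using pos \<open>cos d > 0\<close> by (simp add: add_pos_pos)
    show "cos (2 * of_int i * pi / real n) + sin (2 * of_int i * pi / real n) / cos d
        \<le> cos a + sin a / cos d" for i
      using vertex_local_max[of n "1 / cos d" i\<^sub>0 1 i] n T by (simp add: a_def d_def)
  qed (use n in simp)
  then show ?thesis
    using banach_mazur_dist_le pos \<open>cos d > 0\<close> by (metis add_pos_pos divide_pos_pos)
qed


subsection \<open>Lower bounds\<close>

text \<open>With \<open>L\<close> the linear part of \<open>a\<close>, \<open>u\<close> and
  \<open>w\<close> are the images of the unit vectors under \<open>L\<close>, while \<open>p\<close>
  and \<open>q\<close> are the images of the side normals (1, 1) and (1, -1) under the adjoint of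
  the inverse of \<open>L\<close>. The translation cancels because both \<open>D\<close> and the
  square are symmetric.\<close>

lemma sandwich_dual:
  assumes "convex D" and sym: "\<And>x. x \<in> D \<Longrightarrow> - x \<in> D"
    and a: "affine_transformation a" "a ` regular_polygon 4 \<subseteq> D"
      "D \<subseteq> (\<lambda>x. r *\<^sub>R x) ` (a ` regular_polygon 4)" and "r > 0"
  obtains u w p q where "u \<in> D" "w \<in> D" "p \<bullet> u = 1" "p \<bullet> w = 1" "q \<bullet> u = 1" "q \<bullet> w = -1"
    "\<And>x. x \<in> D \<Longrightarrow> x \<bullet> p \<le> r \<and> x \<bullet> q \<le> r"
proof -
  obtain L v where L: "linear L" "bij L" and a_eq: "a = (\<lambda>x. L x + v)"
    using a(1) by (auto simp: affine_transformation_def)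
  define I where "I = inv L"
  have I: "linear I"
    unfolding I_def using L by (simp add: bij_is_inj inj_linear_imp_inv_linear)
  have IL: "I (L x) = x" for x
    using L(2) by (simp add: I_def bij_is_inj)
  define e1 e2 :: "real^2" where "e1 = vector [1, 0]" and "e2 = vector [0, 1]"
  \<comment> \<open>Averaging \<open>a e\<close> with the reflected point \<open>- a (- e)\<close>
    removes \<open>v\<close>.\<close>
  have half: "L e \<in> D" if "e \<in> regular_polygon 4" for e
  proof -
    have "- e \<in> regular_polygon 4"
      using that by (simp add: regular_polygon_4)
    then have "L e + v \<in> D" "L (- e) + v \<in> D"
      using that a(2) by (auto simp: a_eq)
    then have "L e + v \<in> D" "- (L (- e) + v) \<in> D"
      using sym by blast+
    then have "(1/2) *\<^sub>R (L e + v) + (1/2) *\<^sub>R (- (L (- e) + v)) \<in> D"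
      using \<open>convex D\<close> by (intro convexD) auto
    also have "(1/2) *\<^sub>R (L e + v) + (1/2) *\<^sub>R (- (L (- e) + v)) = L e"
      by (simp add: linear_neg[OF L(1)] scaleR_add_right[symmetric] del: scaleR_minus_right)
    finally show ?thesis .
  qed
  have bound: "x \<bullet> adjoint I y \<le> r" if "x \<in> D" and y: "\<And>z. z \<in> regular_polygon 4 \<Longrightarrow> z \<bullet> y \<le> 1"
    for x y
  proof -
    \<comment> \<open>The translation shifts the upper bound at \<open>x\<close> to
      \<open>r * (1 + s)\<close>, and the lower bound at \<open>- x\<close> yields
      \<open>r * (1 - s)\<close> for \<open>x\<close>; their mean is \<open>r\<close>.\<close>
    define s where "s = v \<bullet> adjoint I y"
    have one: "x' \<bullet> adjoint I y \<le> r * (1 + s)" if "x' \<in> D" for x'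
    proof -
      obtain z where z: "z \<in> regular_polygon 4" "x' = r *\<^sub>R (L z + v)"
        using \<open>x' \<in> D\<close> a(3) unfolding a_eq by blast
      have "L z \<bullet> adjoint I y \<le> 1"
        using y[OF z(1)] by (simp add: adjoint_works[OF I] IL)
      then show ?thesis
        using \<open>r > 0\<close> by (simp add: z(2) inner_add_left s_def)
    qed
    have "x' \<bullet> adjoint I y \<ge> r * (s - 1)" if "x' \<in> D" for x'
    proof -
      obtain z where z: "z \<in> regular_polygon 4" "x' = r *\<^sub>R (L z + v)"
        using \<open>x' \<in> D\<close> a(3) unfolding a_eq by blast
      have "- z \<in> regular_polygon 4"
        using z(1) by (simp add: regular_polygon_4)
      from y[OF this] have "L z \<bullet> adjoint I y \<ge> -1"
        by (simp add: adjoint_works[OF I] IL)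
      then show ?thesis
        using \<open>r > 0\<close> by (simp add: z(2) inner_add_left s_def)
    qed
    from this[OF sym[OF \<open>x \<in> D\<close>]] one[OF \<open>x \<in> D\<close>] show ?thesis
      by (simp add: algebra_simps)
  qed
  show thesis
  proof (rule that)
    show "L e1 \<in> D" "L e2 \<in> D"
      by (auto intro!: half simp: e1_def e2_def regular_polygon_4)
    show "adjoint I (vector [1, 1]) \<bullet> L e1 = 1" "adjoint I (vector [1, 1]) \<bullet> L e2 = 1"
      "adjoint I (vector [1, -1]) \<bullet> L e1 = 1" "adjoint I (vector [1, -1]) \<bullet> L e2 = -1"
      unfolding inner_commute[of "adjoint I _"] adjoint_works[OF I] IL
      by (simp_all add: e1_def e2_def inner_real2)
    show "x \<bullet> adjoint I (vector [1, 1]) \<le> r \<and> x \<bullet> adjoint I (vector [1, -1]) \<le> r" if "x \<in> D" for x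
      by (intro conjI bound that) (auto simp: regular_polygon_4 inner_real2)
  qed
qed

text \<open>Consecutive vertices are \<open>2 * pi / n\<close> apart, so some vertex makes an angle
  of at most \<open>pi / n\<close> with \<open>z\<close>.\<close>

lemma vertex_inner_ge:
  assumes "n > 0"
  shows "\<exists>i. vertex n i \<bullet> z \<ge> cos (pi / real n) * norm z"
proof -
  obtain t where t: "z = norm z *\<^sub>R dir t"
    using real2_polar by blast
  \<comment> \<open>The vertex nearest in angle: a rounding error of 1/2 in the index is an angle of
    \<open>pi / n\<close>.\<close>
  define i where "i = round (t * real n / (2 * pi))"
  have "\<bar>of_int i - t * real n / (2 * pi)\<bar> \<le> 1 / 2"
    unfolding i_def by (rule of_int_round_abs_le)
  then have "\<bar>(of_int i - t * real n / (2 * pi)) * (2 * pi / real n)\<bar> \<le> 1 / 2 * (2 * pi / real n)"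
    using assms unfolding abs_mult by (intro mult_mono) auto
  moreover have "(of_int i - t * real n / (2 * pi)) * (2 * pi / real n) = 2 * of_int i * pi / real n - t"
    using assms by (simp add: field_simps)
  ultimately have "\<bar>2 * of_int i * pi / real n - t\<bar> \<le> 1 / 2 * (2 * pi / real n)"
    by (simp only:)
  then have "\<bar>2 * of_int i * pi / real n - t\<bar> \<le> pi / real n"
    by simp
  then have "cos (pi / real n) \<le> cos \<bar>2 * of_int i * pi / real n - t\<bar>"
    using assms by (intro cos_monotone_0_pi_le) (auto simp: field_simps)
  also have "\<dots> = cos (2 * of_int i * pi / real n - t)"
    by simp
  also have "\<dots> = vertex n i \<bullet> dir t"
    by (simp add: vertex_def inner_real2 cos_diff)
  finally have "cos (pi / real n) * norm z \<le> (vertex n i \<bullet> dir t) * norm z"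
    by (rule mult_right_mono) simp
  also have "\<dots> = vertex n i \<bullet> (norm z *\<^sub>R dir t)"
    by simp
  also have "norm z *\<^sub>R dir t = z"
    using t by simp
  finally show ?thesis by blast
qed

text \<open>The polygon lies between the discs of radii \<open>cos (pi / n)\<close> and 1, so the
  four dual inequalities become Euclidean: \<open>p\<close> and \<open>q\<close> are short, their
  sum and difference are long, and the parallelogram law balances the two.\<close>

lemma sandwich_ge:
  assumes n: "n \<ge> 3" "even n" and "r > 0"
    and a: "affine_transformation a" "a ` regular_polygon 4 \<subseteq> regular_polygon n"
      "regular_polygon n \<subseteq> (\<lambda>x. r *\<^sub>R x) ` (a ` regular_polygon 4)"
  shows "r \<ge> sqrt 2 * cos (pi / real n)"
proof -
  have "n > 0" using n by simp
  define c where "c = cos (pi / real n)"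
  have "c > 0"
    unfolding c_def using pi_divide_nat[OF n(1)] by (rule cos_gt_zero)
  obtain u w p q where uw: "u \<in> regular_polygon n" "w \<in> regular_polygon n"
    and pq: "p \<bullet> u = 1" "p \<bullet> w = 1" "q \<bullet> u = 1" "q \<bullet> w = -1"
    and le: "\<And>x. x \<in> regular_polygon n \<Longrightarrow> x \<bullet> p \<le> r \<and> x \<bullet> q \<le> r"
    using sandwich_dual[OF convex_regular_polygon uminus_regular_polygon[OF \<open>n > 0\<close> n(2)] a \<open>r > 0\<close>]
    by metis
  have "c * norm p \<le> r" "c * norm q \<le> r"
    using le[OF vertex_in_regular_polygon[OF \<open>n > 0\<close>]] vertex_inner_ge[OF \<open>n > 0\<close>] order_trans
    unfolding c_def by meson+
  then have "(c * norm p)\<^sup>2 \<le> r\<^sup>2" "(c * norm q)\<^sup>2 \<le> r\<^sup>2"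
    using \<open>c > 0\<close> by (intro power_mono; simp)+
  \<comment> \<open>\<open>p + q\<close> takes the value 2 at \<open>u\<close>, a point of the unit
    disc; likewise \<open>p - q\<close> at \<open>w\<close>.\<close>
  moreover have "2 \<le> norm (p + q)"
    using norm_cauchy_schwarz[of "p + q" u] norm_regular_polygon_le[OF \<open>n > 0\<close> uw(1)] pq
      mult_left_le[of "norm u" "norm (p + q)"] by (simp add: inner_add_left)
  moreover have "2 \<le> norm (p - q)"
    using norm_cauchy_schwarz[of "p - q" w] norm_regular_polygon_le[OF \<open>n > 0\<close> uw(2)] pq
      mult_left_le[of "norm w" "norm (p - q)"] by (simp add: inner_diff_left)
  moreover have "(norm (p + q))\<^sup>2 + (norm (p - q))\<^sup>2 = 2 * (norm p)\<^sup>2 + 2 * (norm q)\<^sup>2"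
    by (simp add: power2_norm_eq_inner inner_add_left inner_diff_left inner_add_right
        inner_diff_right inner_commute)
  ultimately have "4 \<le> (norm p)\<^sup>2 + (norm q)\<^sup>2"
    using power_mono[of 2 "norm (p + q)" 2] power_mono[of 2 "norm (p - q)" 2] by simp
  then have "c\<^sup>2 * 4 \<le> c\<^sup>2 * ((norm p)\<^sup>2 + (norm q)\<^sup>2)"
    by (rule mult_left_mono) simp
  with \<open>(c * norm p)\<^sup>2 \<le> r\<^sup>2\<close> \<open>(c * norm q)\<^sup>2 \<le> r\<^sup>2\<close> have "(sqrt 2 * c)\<^sup>2 \<le> r\<^sup>2"
    by (simp add: power_mult_distrib distrib_left)
  then show ?thesis
    unfolding c_def[symmetric] by (rule power2_le_imp_le) (use \<open>r > 0\<close> in simp)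
qed

section \<open>Norms invariant under rotation by an eighth of a turn\<close>

text \<open>
  Since \<open>(a + b) e = q + b (e - p)\<close>, the point \<open>q\<close> cannot lie far beyond the line through \<open>e\<close> and
  \<open>(e - p) / \<surd>2\<close>.
\<close>

lemma sector_diff_le:
  fixes N :: "'a::real_vector \<Rightarrow> real"
  assumes tri: "\<And>x y. N (x + y) \<le> N x + N y" and hom: "\<And>c x. N (c *\<^sub>R x) = \<bar>c\<bar> * N x"
    and "N e = N p" "N (p - e) \<le> sqrt 2 * N p" "N p \<le> r" "N q \<le> r"
    and q: "q = b *\<^sub>R p + a *\<^sub>R e" and "a \<ge> 0" "b \<ge> 0"
  shows "N (p - q) \<le> sqrt 2 * r"
proof -
  define g where "g = N p"
  have minus: "N (- x) = N x" for x
    using hom[of "-1" x] by simp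
  have g: "N e = g" "N p = g" "N (p - e) \<le> sqrt 2 * g" "g \<le> r"
    using assms by (simp_all add: g_def)
  have "g \<ge> 0"
    using tri[of p "- p"] hom[of 0 p] minus[of p] by (simp add: g_def)
  have lin: "N (s *\<^sub>R x + t *\<^sub>R y) \<le> s * N x + t * N y" if "s \<ge> 0" "t \<ge> 0" for s t x y
    using tri[of "s *\<^sub>R x" "t *\<^sub>R y"] that by (simp add: hom)
  have ab: "(a + b) *\<^sub>R e = 1 *\<^sub>R q + b *\<^sub>R (- (p - e))"
    by (simp add: q algebra_simps)
  have "N ((a + b) *\<^sub>R e) \<le> 1 * N q + b * N (- (p - e))"
    unfolding ab using \<open>b \<ge> 0\<close> by (intro lin) auto
  then have key: "(a + b) * g \<le> r + b * (sqrt 2 * g)"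
    using g \<open>N q \<le> r\<close> mult_left_mono[OF g(3) \<open>b \<ge> 0\<close>] \<open>a \<ge> 0\<close> \<open>b \<ge> 0\<close> unfolding minus by (simp add: hom)
  \<comment> \<open>This converts the bound \<open>r + (sqrt 2 - 1) * g\<close>, reached in two of
    the three cases below, into \<open>sqrt 2 * r\<close>.\<close>
  have s: "(sqrt 2 - 1) * g \<le> (sqrt 2 - 1) * r"
    using g by (intro mult_left_mono) auto
  show ?thesis
  \<comment> \<open>For \<open>b \<ge> 1\<close> the vector \<open>p\<close> is eliminated in favour
    of \<open>q\<close> and \<open>e\<close>. For \<open>b < 1\<close>, \<open>p - q\<close> is a
    nonnegative combination of \<open>p - e\<close> with \<open>p\<close> or with
    \<open>- e\<close>, according to the sign of \<open>1 - b - a\<close>.\<close>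
  proof (cases "b \<ge> 1")
    case True
    have "p - q = - ((1 - 1 / b) *\<^sub>R q + (a / b) *\<^sub>R e)"
      using True by (simp add: q algebra_simps)
    then have "N (p - q) = N ((1 - 1 / b) *\<^sub>R q + (a / b) *\<^sub>R e)"
      by (simp only: minus)
    also have "\<dots> \<le> (1 - 1 / b) * N q + (a / b) * N e"
      using True \<open>a \<ge> 0\<close> by (intro lin) auto
    also have "\<dots> \<le> (1 - 1 / b) * r + (a / b) * g"
      using \<open>N q \<le> r\<close> True g \<open>a \<ge> 0\<close> by (intro add_mono mult_left_mono) auto
    also have "\<dots> \<le> r + (sqrt 2 - 1) * g"
    proof -
      have "a * g - r \<le> b * ((sqrt 2 - 1) * g)"
        using key by (simp add: algebra_simps)
      then have "(a * g - r) / b \<le> (sqrt 2 - 1) * g"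
        using True by (simp add: field_simps)
      then show ?thesis
        by (simp add: algebra_simps diff_divide_distrib)
    qed
    also have "\<dots> \<le> sqrt 2 * r"
      using s by (simp add: algebra_simps)
    finally show ?thesis .
  next
    case b: False
    show ?thesis
    proof (cases "a \<le> 1 - b")
      case True
      have "p - q = a *\<^sub>R (p - e) + (1 - b - a) *\<^sub>R p"
        by (simp add: q algebra_simps)
      then have "N (p - q) \<le> a * N (p - e) + (1 - b - a) * N p"
        using lin True \<open>a \<ge> 0\<close> by simp
      also have "\<dots> \<le> a * (sqrt 2 * g) + (1 - b - a) * (sqrt 2 * g)"
        using g True \<open>a \<ge> 0\<close> \<open>g \<ge> 0\<close> mult_right_mono[of 1 "sqrt 2" g]
        by (intro add_mono mult_left_mono) auto
      also have "\<dots> = (1 - b) * (sqrt 2 * g)"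
        by (simp add: algebra_simps)
      also have "\<dots> \<le> 1 * (sqrt 2 * r)"
        using g \<open>g \<ge> 0\<close> \<open>b \<ge> 0\<close> b by (intro mult_mono) auto
      finally show ?thesis by simp
    next
      case False
      have "p - q = (1 - b) *\<^sub>R (p - e) + (a + b - 1) *\<^sub>R (- e)"
        by (simp add: q algebra_simps)
      then have "N (p - q) \<le> (1 - b) * N (p - e) + (a + b - 1) * N (- e)"
        using lin[of "1 - b" "a + b - 1" "p - e" "- e"] False b by simp
      also have "\<dots> \<le> (1 - b) * (sqrt 2 * g) + (a + b - 1) * g"
        using g b False by (intro add_mono mult_left_mono) (auto simp: minus)
      also have "\<dots> \<le> sqrt 2 * r"
        using key s by (simp add: algebra_simps)
      finally show ?thesis .
    qed
  qed
qed

definition rot45 :: "real^2 \<Rightarrow> real^2" where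
  "rot45 z = (sqrt 2 / 2) *\<^sub>R vector [z $ 1 - z $ 2, z $ 1 + z $ 2]"

lemma dir_inner_rot45: "dir t \<bullet> rot45 z = dir (t - pi / 4) \<bullet> z"
  unfolding rot45_def inner_real2 dir_nth cos_diff sin_diff cos_45 sin_45 vector_scaleR_component vector_2
  by (simp add: algebra_simps)

text \<open>Let \<open>e\<close> be the quarter turn of \<open>p\<close>. The diagonals
  \<open>p + e\<close> and \<open>p - e\<close> are, up to sign, \<open>sqrt 2\<close> times eighth
  turns of \<open>p\<close> and \<open>e\<close>, hence have norm exactly
  \<open>sqrt 2 * N p\<close>. This is the input that \<open>sector_diff_le\<close> needs in each
  quadrant.\<close>

lemma james_rot45:
  fixes N :: "real^2 \<Rightarrow> real"
  assumes tri: "\<And>x y. N (x + y) \<le> N x + N y" and hom: "\<And>c x. N (c *\<^sub>R x) = \<bar>c\<bar> * N x"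
    and rot: "\<And>x. N (rot45 x) = N x"
    and "p \<noteq> 0" and pq: "N p \<le> r" "N q \<le> r"
  shows "N (p - q) \<le> sqrt 2 * r \<or> N (p + q) \<le> sqrt 2 * r"
proof -
  define e where "e = rot45 (rot45 p)"
  have e: "e = vector [- p $ 2, p $ 1]"
    by (simp add: e_def rot45_def vec_eq_iff forall_2 field_simps)
  have minus: "N (- x) = N x" for x
    using hom[of "-1" x] by simp
  have "p + e = sqrt 2 *\<^sub>R rot45 p"
    by (simp add: e rot45_def vec_eq_iff forall_2)
  then have plus: "N (p + e) = sqrt 2 * N p"
    by (simp add: hom rot)
  have "e - p = sqrt 2 *\<^sub>R rot45 e"
    by (simp add: e rot45_def vec_eq_iff forall_2)
  then have "N (p - e) = sqrt 2 * N p"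
    using minus[of "p - e"] by (simp add: hom rot e_def)
  have ep: "N e = N p"
    by (simp add: e_def rot)
  \<comment> \<open>Coordinates of \<open>q\<close> in the orthogonal basis \<open>p\<close>,
    \<open>e\<close>, whose vectors have equal Euclidean length.\<close>
  define b where "b = (p \<bullet> q) / (p \<bullet> p)"
  define a where "a = (e \<bullet> q) / (p \<bullet> p)"
  have pp: "p \<bullet> p \<noteq> 0"
    using \<open>p \<noteq> 0\<close> by simp
  have "(p \<bullet> p) *\<^sub>R q = (p \<bullet> q) *\<^sub>R p + (e \<bullet> q) *\<^sub>R e"
    by (simp add: inner_real2 e vec_eq_iff forall_2 algebra_simps)
  then have "(1 / (p \<bullet> p)) *\<^sub>R ((p \<bullet> p) *\<^sub>R q) = (1 / (p \<bullet> p)) *\<^sub>R ((p \<bullet> q) *\<^sub>R p + (e \<bullet> q) *\<^sub>R e)"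
    by simp
  then have q: "q = b *\<^sub>R p + a *\<^sub>R e"
    using pp by (simp add: a_def b_def scaleR_add_right)
  note sec = sector_diff_le[of N, OF tri hom]
  show ?thesis
  \<comment> \<open>The sign of \<open>b\<close> decides between \<open>p - q\<close> and
    \<open>p + q\<close>, by passing to \<open>- q\<close>. A negative coefficient of
    \<open>e\<close> is repaired by replacing \<open>e\<close> with \<open>- e\<close>.\<close>
  proof (cases "b \<ge> 0")
    case True
    have "N (p - q) \<le> sqrt 2 * r"
    proof (cases "a \<ge> 0")
      case a: True
      show ?thesis
        by (rule sec[of e p r q b a]) (use True a q pq ep \<open>N (p - e) = _\<close> in auto)
    next
      case False
      show ?thesis
        by (rule sec[of "- e" p r q b "- a"]) (use True False q pq ep minus plus in auto)
    qed
    then show ?thesis ..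
  next
    case b: False
    have nq: "N (- q) \<le> r"
      using pq minus by simp
    have "N (p - (- q)) \<le> sqrt 2 * r"
    proof (cases "a \<ge> 0")
      case True
      show ?thesis
        by (rule sec[of "- e" p r "- q" "- b" a, OF _ _ pq(1) nq])
          (use True b ep minus plus in \<open>simp_all add: q\<close>)
    next
      case a: False
      show ?thesis
        by (rule sec[of e p r "- q" "- b" "- a", OF _ _ pq(1) nq])
          (use a b ep \<open>N (p - e) = _\<close> in \<open>simp_all add: q\<close>)
    qed
    then show ?thesis by simp
  qed
qed

section \<open>The support function of a regular polygon\<close>

text \<open>Vertices suffice, since a linear functional on the polygon is bounded by its values
  there; for even \<open>n\<close> this is the dual norm to which \<open>james_rot45\<close> is
  applied.\<close>

definition polygon_support :: "nat \<Rightarrow> real^2 \<Rightarrow> real" where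
  "polygon_support n z = (SUP i. vertex n i \<bullet> z)"

lemma vertex_inner_le_support: "vertex n i \<bullet> z \<le> polygon_support n z"
proof -
  have "vertex n i \<bullet> z \<le> norm z" for i
    using norm_cauchy_schwarz[of "vertex n i" z] by (simp add: vertex_def)
  then show ?thesis
    unfolding polygon_support_def by (intro cSUP_upper bdd_aboveI2[of _ _ "norm z"]) auto
qed

lemma polygon_support_least: "(\<And>i. vertex n i \<bullet> z \<le> r) \<Longrightarrow> polygon_support n z \<le> r"
  unfolding polygon_support_def by (rule cSUP_least) auto

lemma inner_le_support:
  assumes "n > 0" "x \<in> regular_polygon n"
  shows "x \<bullet> z \<le> polygon_support n z"
proof -
  have "regular_polygon n \<subseteq> {x. z \<bullet> x \<le> polygon_support n z}"
    using assms(1) vertex_inner_le_support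
    by (intro regular_polygon_minimal convex_halfspace_le) (auto simp: inner_commute)
  then show ?thesis
    using assms(2) by (auto simp: inner_commute)
qed

lemma polygon_support_add: "polygon_support n (x + y) \<le> polygon_support n x + polygon_support n y"
  by (intro polygon_support_least) (simp add: inner_add_right add_mono vertex_inner_le_support)

lemma polygon_support_scaleR:
  assumes "n > 0" "even n"
  shows "polygon_support n (c *\<^sub>R x) = \<bar>c\<bar> * polygon_support n x"
proof -
  have abs_le: "\<bar>vertex n i \<bullet> x\<bar> \<le> polygon_support n x" for i x
    using vertex_inner_le_support[of n i x] vertex_inner_le_support[of n "i + int (n div 2)" x]
      uminus_vertex[OF assms, of i, symmetric] by simp
  have le: "polygon_support n (c *\<^sub>R x) \<le> \<bar>c\<bar> * polygon_support n x" for c x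
  proof (rule polygon_support_least)
    fix i
    have "vertex n i \<bullet> (c *\<^sub>R x) \<le> \<bar>c\<bar> * \<bar>vertex n i \<bullet> x\<bar>"
      by (metis abs_ge_self abs_mult inner_scaleR_right)
    also have "\<dots> \<le> \<bar>c\<bar> * polygon_support n x"
      by (intro mult_left_mono abs_le) simp
    finally show "vertex n i \<bullet> (c *\<^sub>R x) \<le> \<bar>c\<bar> * polygon_support n x" .
  qed
  show ?thesis
  proof (cases "c = 0")
    case True
    then show ?thesis by (simp add: polygon_support_def)
  next
    case False
    \<comment> \<open>The reverse inequality is the first one applied to the inverse
      scaling.\<close>
    have "\<bar>c\<bar> * polygon_support n x \<le> polygon_support n (c *\<^sub>R x)"
      using le[of "1 / c" "c *\<^sub>R x"] False by (simp add: field_simps abs_divide)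
    with le show ?thesis by (simp add: antisym)
  qed
qed

text \<open>An eighth of a turn is \<open>j\<close> steps of the \<open>8 * j\<close>-gon, so the
  rotation only permutes the vertices over which the supremum is taken.\<close>

lemma polygon_support_rot45:
  assumes "j \<ge> 1"
  shows "polygon_support (8 * j) (rot45 z) = polygon_support (8 * j) z"
proof -
  have v: "vertex (8 * j) i \<bullet> rot45 z = vertex (8 * j) (i - int j) \<bullet> z" for i
  proof -
    have "2 * of_int i * pi / real (8 * j) - pi / 4 = 2 * of_int (i - int j) * pi / real (8 * j)"
      using assms by (simp add: field_simps)
    then show ?thesis
      by (simp only: vertex_def dir_inner_rot45)
  qed
  show ?thesis
  proof (intro antisym polygon_support_least)
    show "vertex (8 * j) i \<bullet> rot45 z \<le> polygon_support (8 * j) z" for i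
      unfolding v by (rule vertex_inner_le_support)
    show "vertex (8 * j) i \<bullet> z \<le> polygon_support (8 * j) (rot45 z)" for i
      using vertex_inner_le_support[of "8 * j" "i + int j" "rot45 z"] unfolding v by simp
  qed
qed

lemma sandwich_ge_sqrt2:
  assumes "j \<ge> 1" and "r > 0"
    and a: "affine_transformation a" "a ` regular_polygon 4 \<subseteq> regular_polygon (8 * j)"
      "regular_polygon (8 * j) \<subseteq> (\<lambda>x. r *\<^sub>R x) ` (a ` regular_polygon 4)"
  shows "r \<ge> sqrt 2"
proof -
  let ?P = "regular_polygon (8 * j)" and ?h = "polygon_support (8 * j)"
  have n: "8 * j > 0" "even (8 * j)" using \<open>j \<ge> 1\<close> by simp_all
  obtain u w p q where uw: "u \<in> ?P" "w \<in> ?P"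
    and pq: "p \<bullet> u = 1" "p \<bullet> w = 1" "q \<bullet> u = 1" "q \<bullet> w = -1"
    and le: "\<And>x. x \<in> ?P \<Longrightarrow> x \<bullet> p \<le> r \<and> x \<bullet> q \<le> r"
    using sandwich_dual[OF convex_regular_polygon uminus_regular_polygon[OF n] a \<open>r > 0\<close>]
    by metis
  have "?h p \<le> r" "?h q \<le> r"
    using le vertex_in_regular_polygon[OF n(1)] by (auto intro!: polygon_support_least)
  moreover have "p \<noteq> 0"
    using pq by auto
  ultimately have "?h (p - q) \<le> sqrt 2 * r \<or> ?h (p + q) \<le> sqrt 2 * r"
    using \<open>j \<ge> 1\<close> n
    by (intro james_rot45 polygon_support_add polygon_support_scaleR polygon_support_rot45)
  moreover have "2 \<le> ?h (p + q)" "2 \<le> ?h (p - q)"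
    using inner_le_support[OF n(1) uw(1), of "p + q"] inner_le_support[OF n(1) uw(2), of "p - q"] pq
    by (simp_all add: inner_add_right inner_diff_right inner_commute)
  \<comment> \<open>Both supports are at least 2, so whichever alternative holds gives
    \<open>2 \<le> sqrt 2 * r\<close>.\<close>
  ultimately have "sqrt 2 * sqrt 2 \<le> sqrt 2 * r"
    by (simp add: algebra_simps) linarith
  then show ?thesis
    by (rule mult_left_le_imp_le) simp
qed

section \<open>The four families of polygons\<close>

lemma banach_mazur_dist_eqI:
  assumes "r > 0"
    and "\<exists>a. affine_transformation a \<and> a ` C \<subseteq> D \<and> D \<subseteq> (\<lambda>x. r *\<^sub>R x) ` (a ` C)"
    and "\<And>s a. s > 0 \<Longrightarrow> affine_transformation a \<Longrightarrow> a ` C \<subseteq> D \<Longrightarrow>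
      D \<subseteq> (\<lambda>x. s *\<^sub>R x) ` (a ` C) \<Longrightarrow> r \<le> s"
  shows "banach_mazur_dist C D = r"
  unfolding banach_mazur_dist_def
proof (rule cInf_eq_minimum)
  show "r \<in> {r. r > 0 \<and> (\<exists>a. affine_transformation a \<and>
      a ` C \<subseteq> D \<and> D \<subseteq> (\<lambda>x. r *\<^sub>R x) ` (a ` C))}"
    using assms(1,2) by simp
qed (elim CollectE exE conjE, rule assms(3))

lemma vector_0_1_in_regular_polygon:
  assumes "n > 0" "4 dvd n"
  shows "vector [0, 1] \<in> regular_polygon n"
proof -
  obtain m where m: "n = 4 * m" using assms by blast
  have e: "2 * real_of_int (int m) * pi / real n = pi / 2"
    using assms m by (simp add: field_simps)
  then have "vertex n (int m) = vector [0, 1]"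
    unfolding vertex_def e by (simp add: vec_eq_iff forall_2)
  then show ?thesis
    using vertex_in_regular_polygon[OF assms(1)] by metis
qed

lemma cos_plus_sin: "cos t + sin t = sqrt 2 * cos (t - pi / 4)"
  by (simp add: cos_diff cos_45 sin_45 algebra_simps)

lemma banach_mazur_dist_8j:
  assumes "j \<ge> 1"
  shows "banach_mazur_dist (regular_polygon 4) (regular_polygon (8 * j)) = sqrt 2"
proof (rule banach_mazur_dist_eqI)
  show "\<exists>a. affine_transformation a \<and> a ` regular_polygon 4 \<subseteq> regular_polygon (8 * j) \<and>
    regular_polygon (8 * j) \<subseteq> (\<lambda>x. sqrt 2 *\<^sub>R x) ` (a ` regular_polygon 4)"
    using assms by (intro rhombus_sandwich[where c = 1] vector_0_1_in_regular_polygon)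
      (auto simp: cos_plus_sin)
qed (simp, rule sandwich_ge_sqrt2[OF assms])

text \<open>The direction \<open>pi / 4\<close> is the odd multiple \<open>2 * j + 1\<close> of
  \<open>pi / n\<close>, hence midway between two vertices. So \<open>cos t + sin t\<close> reaches
  only \<open>sqrt 2 * cos (pi / n)\<close> on the vertices, which matches
  \<open>sandwich_ge\<close>.\<close>

lemma banach_mazur_dist_8j_4:
  shows "banach_mazur_dist (regular_polygon 4) (regular_polygon (8 * j + 4))
    = sqrt 2 * cos (pi / real (8 * j + 4))"
proof (rule banach_mazur_dist_eqI)
  let ?n = "8 * j + 4"
  show pos: "sqrt 2 * cos (pi / real ?n) > 0"
    using pi_divide_nat[of ?n] by (intro mult_pos_pos cos_gt_zero) simp_all
  show "\<exists>a. affine_transformation a \<and> a ` regular_polygon 4 \<subseteq> regular_polygon ?n \<and>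
    regular_polygon ?n \<subseteq> (\<lambda>x. (sqrt 2 * cos (pi / real ?n)) *\<^sub>R x) ` (a ` regular_polygon 4)"
  proof (rule rhombus_sandwich[where c = 1])
    fix i :: int
    \<comment> \<open>In units of \<open>pi / n\<close> the vertex has an even position and
      \<open>pi / 4\<close> an odd one; their difference is thus nonzero modulo
      \<open>2 * n\<close>, the number of units in a full turn.\<close>
    have "\<not> 2 dvd 2 * i - (2 * int j + 1)"
      by presburger
    then have "\<not> int (2 * ?n) dvd 2 * i - (2 * int j + 1)"
      by (metis dvd_mult_left of_nat_mult of_nat_numeral)
    then have "cos (2 * of_int (2 * i - (2 * int j + 1)) * pi / real (2 * ?n)) \<le> cos (2 * pi / real (2 * ?n))"
      by (intro cos_nonzero_multiple_le) auto
    also have "2 * pi / real (2 * ?n) = pi / real ?n"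
      by (simp add: field_simps)
    also have "2 * of_int (2 * i - (2 * int j + 1)) * pi / real (2 * ?n) = 2 * of_int i * pi / real ?n - pi / 4"
      by (simp add: field_simps)
    finally show "cos (2 * of_int i * pi / real ?n) + sin (2 * of_int i * pi / real ?n) / 1
      \<le> sqrt 2 * cos (pi / real ?n)"
      by (simp add: cos_plus_sin)
  qed (use pos in \<open>auto intro!: vector_0_1_in_regular_polygon\<close>)
qed (rule sandwich_ge, simp_all)

text \<open>Vertex \<open>j\<close> lies just below the diagonal direction, with
  \<open>2 * a = pi / 2 - d\<close>. Then \<open>cos d = sin (2 * a)\<close>, and the double-angle
  formula turns \<open>sin a / cos d\<close> into half a secant.\<close>

lemma banach_mazur_dist_8j_2:
  assumes "j \<ge> 1"
  shows "banach_mazur_dist (regular_polygon 4) (regular_polygon (8 * j + 2))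
    \<le> 1 / 2 * (1 / cos (2 * real j / (8 * real j + 2) * pi)) + cos (2 * real j / (8 * real j + 2) * pi)"
proof -
  define d where "d = pi / real (8 * j + 2)"
  define a where "a = 2 * of_int (int j) * pi / real (8 * j + 2)"
  have a2: "2 * a = pi / 2 - d"
    by (simp add: a_def d_def field_simps)
  have d: "0 < d" "d < pi / 2"
    using assms pi_divide_nat[of "8 * j + 2"] by (simp_all add: d_def)
  then have a: "0 < a" "a < pi / 2"
    using a2 by linarith+
  have s: "sin (2 * a) = cos d" "cos (2 * a) = sin d"
    unfolding a2 by (simp_all add: sin_diff cos_diff)
  have "sin d > 0" "cos a > 0" "sin a > 0"
    using d a by (auto intro!: sin_gt_zero cos_gt_zero)
  have "banach_mazur_dist (regular_polygon 4) (regular_polygon (8 * j + 2)) \<le> cos a + sin a / cos d"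
    using banach_mazur_dist_rhombus_le[of "8 * j + 2" "int j"] a s assms \<open>sin d > 0\<close>
    unfolding a_def d_def by simp
  also have "sin a / cos d = 1 / 2 * (1 / cos a)"
    using \<open>cos a > 0\<close> \<open>sin a > 0\<close> by (simp add: s(1)[symmetric] sin_double)
  also have "a = 2 * real j / (8 * real j + 2) * pi"
    by (simp add: a_def)
  finally show ?thesis by simp
qed

text \<open>Here the vertex nearest to the diagonal direction is \<open>j + 1\<close>, just above
  it, with \<open>2 * a = pi / 2 + d\<close>. The cosecant in the bound is \<open>1 / cos d\<close>,
  as its angle is \<open>pi / 2 - d\<close>.\<close>

lemma banach_mazur_dist_8j_6:
  shows "banach_mazur_dist (regular_polygon 4) (regular_polygon (8 * j + 6))
    \<le> sin ((2 * real j + 2) / (8 * real j + 6) * pi)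
        * (1 / sin ((4 * real j + 2) / (8 * real j + 6) * pi))
      + cos ((2 * real j + 2) / (8 * real j + 6) * pi)"
proof -
  define d where "d = pi / real (8 * j + 6)"
  define a where "a = 2 * of_int (int j + 1) * pi / real (8 * j + 6)"
  have a2: "2 * a = pi / 2 + d"
    by (simp add: a_def d_def field_simps)
  have d: "0 < d" "d < pi / 2"
    using pi_divide_nat[of "8 * j + 6"] by (simp_all add: d_def)
  then have a: "0 < a" "a < pi / 2"
    using a2 by linarith+
  have s: "sin (2 * a) = cos d" "cos (2 * a) = - sin d"
    unfolding a2 by (simp_all add: sin_add cos_add)
  have "sin d > 0"
    using d by (auto intro!: sin_gt_zero)
  have "banach_mazur_dist (regular_polygon 4) (regular_polygon (8 * j + 6)) \<le> cos a + sin a / cos d"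
    using banach_mazur_dist_rhombus_le[of "8 * j + 6" "int j + 1"] a s \<open>sin d > 0\<close>
    unfolding a_def d_def by simp
  also have "cos d = sin ((4 * real j + 2) / (8 * real j + 6) * pi)"
  proof -
    have "(4 * real j + 2) / (8 * real j + 6) * pi = pi / 2 - d"
      by (simp add: d_def field_simps)
    then show ?thesis by (simp add: sin_diff)
  qed
  also have "a = (2 * real j + 2) / (8 * real j + 6) * pi"
    by (simp add: a_def field_simps)
  finally show ?thesis by simp
qed

theorem theorem2:
  fixes j :: nat
  assumes "j \<ge> 1"
  shows
    "banach_mazur_dist (regular_polygon 4) (regular_polygon (8 * j)) = sqrt 2 \<and>
     banach_mazur_dist (regular_polygon 4) (regular_polygon (8 * j + 2))
       \<le> 1 / 2 * (1 / cos (2 * real j / (8 * real j + 2) * pi))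
         + cos (2 * real j / (8 * real j + 2) * pi) \<and>
     banach_mazur_dist (regular_polygon 4) (regular_polygon (8 * j + 4))
       = sqrt 2 * cos (1 / (8 * real j + 4) * pi) \<and>
     banach_mazur_dist (regular_polygon 4) (regular_polygon (8 * j + 6))
       \<le> sin ((2 * real j + 2) / (8 * real j + 6) * pi)
           * (1 / sin ((4 * real j + 2) / (8 * real j + 6) * pi))
         + cos ((2 * real j + 2) / (8 * real j + 6) * pi)"
proof (intro conjI)
  show "banach_mazur_dist (regular_polygon 4) (regular_polygon (8 * j + 4))
       = sqrt 2 * cos (1 / (8 * real j + 4) * pi)"
    using banach_mazur_dist_8j_4[of j] by simp
qed (fact banach_mazur_dist_8j[OF assms] banach_mazur_dist_8j_2[OF assms] banach_mazur_dist_8j_6)+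

end
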